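(* Let $m\ge n\ge 1$ and $A\in\mathbb{R}^{m\times n}$. Then for all integers $k$ with $n\le k\le m$, $$\binom{m-n}{k-n}\det(A^TA)=\sum_{1\le i_1<\dots<i_k\le m}\big(\mathrm{Gdet}(A_{i_1,i_2,\dots,i_k})\big)^2,$$ where $A_{i_1,\dots,i_k}$ is the $k\times n$ submatrix of $A$ formed by rows $i_1,\dots,i_k$.
   Context: All matrices are real. Let $m\ge n\ge 1$. $S_m$ is the symmetric group on $\{1,\dots,m\}$ with identity element $(1)$. For $\sigma\in S_m$ let $\Phi(\sigma)$ be the $m\times m$ permutation matrix whose $i$-th row is $e_{\sigma(i)}^T$ ($e_j$ = $j$-th column of $I_m$), let $I_{m\times n}=(e_1,\dots,e_n)$, and $P_\sigma=\Phi(\sigma)I_{m\times n}\in\mathbb{R}^{m\times n}$. For $A\in\mathbb{R}^{m\times n}$ put $A^\sigma=P_\sigma^TA\in\mathbb{R}^{n\times n}$ (so the $j$-th row of $A^\sigma$ is the $\sigma^{-1}(j)$-th row of $A$). Totally order $S_m$ by: $\sigma>\tau$ iff there is $t$ with $\sigma(t)>\tau(t)$ and $\sigma(j)=\tau(j)$ for all $j>t$. Let $\sigma_A=(1)$ if $A$ is not of full column rank, and otherwise $\sigma_A=\max\{\sigma\in S_m:\det(A^\sigma)\neq 0\}$. The principal submatrix of $A$ is $A_P=A^{\sigma_A}$, and $\mathrm{sign}(A)\in\{1,0,-1\}$ is the sign of the real number $\det(A_P)$. The generalized determinant of a matrix $A\in\mathbb{R}^{m\times n}$ with $m\ge n$ (and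 likewise of a $k\times n$ matrix with $k\ge n$) is $$\mathrm{Gdet}(A)=\mathrm{sign}(A)\Big(\sum_{1\le i_1<\dots<i_n\le m}\det(A_{i_1,\dots,i_n})^2\Big)^{1/2},$$ where $A_{i_1,\dots,i_n}$ is the $n\times n$ submatrix formed by rows $i_1,\dots,i_n$ of $A$. *)

theory Defs
  imports
    "Jordan_Normal_Form.DL_Rank_Submatrix"
    "HOL-Combinatorics.Permutations"
    Complex_Main
begin

(* Rows, columns and the points moved by permutations are numbered from 0, as in the matrix
   library: S_m is {s. s permutes {..<m}} and its identity is id. *)

definition perm_mat :: "nat \<Rightarrow> (nat \<Rightarrow> nat) \<Rightarrow> real mat" where
  "perm_mat m s = mat m m (\<lambda>(i, j). if j = s i then 1 else 0)"

definition rect_id :: "nat \<Rightarrow> nat \<Rightarrow> real mat" where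
  "rect_id m n = mat m n (\<lambda>(i, j). if i = j then 1 else 0)"

definition perm_proj :: "nat \<Rightarrow> nat \<Rightarrow> (nat \<Rightarrow> nat) \<Rightarrow> real mat" where
  "perm_proj m n s = perm_mat m s * rect_id m n"

definition perm_part :: "real mat \<Rightarrow> (nat \<Rightarrow> nat) \<Rightarrow> real mat" where
  "perm_part A s = transpose_mat (perm_proj (dim_row A) (dim_col A) s) * A"

lemma perm_part_index:
  assumes s: "s permutes {..<m}" and A: "A \<in> carrier_mat m n" and "n \<le> m" "j < n" "l < n"
  shows "perm_part A s $$ (j, l) = A $$ (inv_into UNIV s j, l)"
proof -
  have P: "perm_proj m n s $$ (i, j) = (if i = inv_into UNIV s j then 1 else 0)" if "i < m" for i
  proof -
    have "s i < m" using s that permutes_in_image by fastforce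
    then have "perm_proj m n s $$ (i, j) =
        (\<Sum>k\<in>{0..<m}. (if k = s i then 1 else 0) * (if k = j then 1 else 0))"
      using that assms by (simp add: perm_proj_def perm_mat_def rect_id_def scalar_prod_def)
    also have "\<dots> = (\<Sum>k\<in>{0..<m}. if k = s i then if k = j then 1 else 0 else 0)"
      by (intro sum.cong) auto
    also have "\<dots> = (if s i = j then 1 else 0)"
      using \<open>s i < m\<close> by (subst sum.delta) auto
    finally have e: "perm_proj m n s $$ (i, j) = (if s i = j then 1 else 0)" .
    have "(i = inv_into UNIV s j) = (s i = j)"
      using permutes_inv_eq[OF s, of j i] by (simp only: eq_commute[of i])
    then show ?thesis by (simp only: e)
  qed
  have d: "dim_row (perm_proj m n s) = m" "dim_col (perm_proj m n s) = n"
    by (simp_all add: perm_proj_def perm_mat_def rect_id_def)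
  have "inv_into UNIV s j < m"
    using permutes_in_image[OF permutes_inv[OF s]] assms by auto
  have "perm_part A s $$ (j, l) = (\<Sum>i\<in>{0..<m}. perm_proj m n s $$ (i, j) * A $$ (i, l))"
    using assms d by (auto simp: perm_part_def scalar_prod_def)
  also have "\<dots> = (\<Sum>i\<in>{0..<m}. if i = inv_into UNIV s j then A $$ (i, l) else 0)"
    by (intro sum.cong) (auto simp: P)
  also have "\<dots> = A $$ (inv_into UNIV s j, l)"
    using \<open>inv_into UNIV s j < m\<close> by (subst sum.delta) auto
  finally show ?thesis .
qed

definition perm_less :: "nat \<Rightarrow> (nat \<Rightarrow> nat) \<Rightarrow> (nat \<Rightarrow> nat) \<Rightarrow> bool" where
  "perm_less m r s \<longleftrightarrow> (\<exists>t<m. r t < s t \<and> (\<forall>j. t < j \<and> j < m \<longrightarrow> r j = s j))"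

definition perm_max :: "nat \<Rightarrow> (nat \<Rightarrow> nat) set \<Rightarrow> (nat \<Rightarrow> nat)" where
  "perm_max m S = (THE s. s \<in> S \<and> (\<forall>r\<in>S. r \<noteq> s \<longrightarrow> perm_less m r s))"

lemma perm_less_trans:
  assumes "perm_less m p r" "perm_less m r s"
  shows "perm_less m p s"
proof -
  obtain t where t: "t < m" "p t < r t" "\<forall>j. t < j \<and> j < m \<longrightarrow> p j = r j"
    using assms(1) unfolding perm_less_def by blast
  obtain u where u: "u < m" "r u < s u" "\<forall>j. u < j \<and> j < m \<longrightarrow> r j = s j"
    using assms(2) unfolding perm_less_def by blast
  consider "t < u" | "t = u" | "u < t" by linarith
  then show ?thesis
  proof cases
    case 1
    then show ?thesis unfolding perm_less_def using t u by (intro exI[of _ u]) auto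
  next
    case 2
    then show ?thesis unfolding perm_less_def using t u by (intro exI[of _ u]) auto
  next
    case 3
    then show ?thesis unfolding perm_less_def using t u by (intro exI[of _ t]) auto
  qed
qed

lemma perm_less_irrefl: "\<not> perm_less m s s"
  unfolding perm_less_def by auto

lemma perm_less_total:
  assumes r: "r permutes {..<m}" and s: "s permutes {..<m}" and "r \<noteq> s"
  shows "perm_less m r s \<or> perm_less m s r"
proof -
  let ?D = "{j. j < m \<and> r j \<noteq> s j}"
  have "?D \<noteq> {}"
    using assms by (auto simp: fun_eq_iff) (metis lessThan_iff permutes_not_in)
  then have M: "Max ?D \<in> ?D" by (intro Max_in) auto
  define t where "t = Max ?D"
  have t: "t < m" "r t \<noteq> s t" using M unfolding t_def by auto
  have eq: "\<forall>j. t < j \<and> j < m \<longrightarrow> r j = s j"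
  proof (intro allI impI, rule ccontr)
    fix j assume j: "t < j \<and> j < m" "r j \<noteq> s j"
    then have "j \<le> t" unfolding t_def by (intro Max_ge) auto
    then show False using j by simp
  qed
  consider "r t < s t" | "s t < r t" using t(2) by linarith
  then show ?thesis
  proof cases
    case 1
    then have "perm_less m r s" unfolding perm_less_def using t eq by (intro exI[of _ t]) simp
    then show ?thesis ..
  next
    case 2
    then have "perm_less m s r" unfolding perm_less_def using t eq by (intro exI[of _ t]) simp
    then show ?thesis ..
  qed
qed

lemma perm_max_ex1:
  assumes S: "S \<subseteq> {s. s permutes {..<m}}" and ne: "S \<noteq> {}"
  shows "\<exists>!s. s \<in> S \<and> (\<forall>r\<in>S. r \<noteq> s \<longrightarrow> perm_less m r s)"
proof -
  have "finite S" using S by (rule finite_subset) (simp add: finite_permutations)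
  then have "\<exists>s\<in>S. \<forall>r\<in>S. r \<noteq> s \<longrightarrow> perm_less m r s"
    using ne S
  proof (induction S rule: finite_ne_induct)
    case (singleton x)
    then show ?case by simp
  next
    case (insert x F)
    then obtain s where s: "s \<in> F" "\<forall>r\<in>F. r \<noteq> s \<longrightarrow> perm_less m r s" by auto
    have "perm_less m x s \<or> perm_less m s x"
      using insert.prems insert.hyps s by (intro perm_less_total) auto
    then show ?case
    proof
      assume "perm_less m x s"
      then show ?thesis using s by auto
    next
      assume "perm_less m s x"
      then have "\<forall>r\<in>insert x F. r \<noteq> x \<longrightarrow> perm_less m r x"
        proof (intro ballI impI)
        fix r assume "r \<in> insert x F" "r \<noteq> x"
        then show "perm_less m r x"
          using s \<open>perm_less m s x\<close> perm_less_trans[of m r s x] by (cases "r = s") auto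
      qed
      then show ?thesis by blast
    qed
  qed
  then obtain s where s: "s \<in> S" "\<forall>r\<in>S. r \<noteq> s \<longrightarrow> perm_less m r s" by blast
  show ?thesis
  proof (rule ex1I[of _ s])
    show "s \<in> S \<and> (\<forall>r\<in>S. r \<noteq> s \<longrightarrow> perm_less m r s)" using s by simp
  next
    fix u assume u: "u \<in> S \<and> (\<forall>r\<in>S. r \<noteq> u \<longrightarrow> perm_less m r u)"
    show "u = s"
    proof (rule ccontr)
      assume "u \<noteq> s"
      then have "perm_less m u s" "perm_less m s u" using s u by auto
      then show False using perm_less_trans perm_less_irrefl by meson
    qed
  qed
qed

definition full_col_rank :: "real mat \<Rightarrow> bool" where
  "full_col_rank A \<longleftrightarrow> vec_space.rank (dim_row A) A = dim_col A"

definition principal_perm :: "real mat \<Rightarrow> (nat \<Rightarrow> nat)" where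
  "principal_perm A =
     (if full_col_rank A
      then perm_max (dim_row A) {s. s permutes {..<dim_row A} \<and> det (perm_part A s) \<noteq> 0}
      else id)"

definition principal_submatrix :: "real mat \<Rightarrow> real mat" where
  "principal_submatrix A = perm_part A (principal_perm A)"

definition mat_sign :: "real mat \<Rightarrow> real" where
  "mat_sign A = sgn (det (principal_submatrix A))"

(* The rows with index in I, in increasing order. An increasing k-tuple of row indices is
   represented by the k-element set of its entries. *)
abbreviation rows_submatrix :: "real mat \<Rightarrow> nat set \<Rightarrow> real mat" where
  "rows_submatrix A I \<equiv> submatrix A I UNIV"

(* The intended domain is dim_col A \<le> dim_row A. *)
definition Gdet :: "real mat \<Rightarrow> real" where
  "Gdet A = mat_sign A *
     sqrt (\<Sum>I\<in>{I. I \<subseteq> {..<dim_row A} \<and> card I = dim_col A}. (det (rows_submatrix A I))\<^sup>2)"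

end

theory Submission
  imports Defs
begin

text \<open>
  A nonzero maximal minor makes the sign in the definition of \<open>Gdet\<close> nonzero, so
  \<open>(Gdet B)\<^sup>2\<close> is the sum of the squared maximal minors of \<open>B\<close>. By the Cauchy--Binet formula for a
  set \<open>K\<close> of rows, the summand for \<open>K\<close> on the right-hand side is therefore the sum of the squared
  maximal minors of \<open>A\<close> with rows in \<open>K\<close>. Each maximal minor is counted once for every
  \<open>k\<close>-element set of rows that contains its rows, which gives the binomial coefficient.
\<close>

section \<open>Selecting rows with \<open>pick\<close>\<close>

lemma bij_betw_pick:
  assumes "finite I" "card I = n"
  shows "bij_betw (pick I) {..<n} I"
proof -
  have "inj_on (pick I) {..<n}"
    by (rule linorder_inj_onI) (use assms pick_mono_le in force)+
  moreover have "pick I ` {..<n} \<subseteq> I"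
    using assms pick_in_set_le by auto
  ultimately show ?thesis
    using assms by (simp add: bij_betw_def card_image card_subset_eq)
qed

lemma submatrix_UNIV_eq:
  assumes "A \<in> carrier_mat m n" "I \<subseteq> {..<m}" "card I = k"
  shows "submatrix A I UNIV = mat k n (\<lambda>(i, j). A $$ (pick I i, j))"
proof -
  have "{i. i < m \<and> i \<in> I} = I" using assms(2) by auto
  then show ?thesis
    using assms by (auto simp: submatrix_def pick_UNIV)
qed

section \<open>The Cauchy--Binet formula and Gram determinants\<close>

lemma det_mat:
  "det (mat n n (\<lambda>(i, j). f i j)) = (\<Sum>p | p permutes {..<n}. signof p * (\<Prod>i<n. f i (p i)))"
proof -
  have "(\<Prod>i<n. mat n n (\<lambda>(i, j). f i j) $$ (i, p i)) = (\<Prod>i<n. f i (p i))"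
    if "p permutes {..<n}" for p
    using permutes_in_image[OF that] by (intro prod.cong) auto
  then show ?thesis
    by (subst det_def'[of _ n]) (auto simp: atLeast0LessThan intro!: sum.cong)
qed

lemma det_rows_not_inj:
  assumes "\<not> inj_on f {..<n}"
  shows "det (mat n n (\<lambda>(i, j). b (f i) j)) = (0 :: 'a :: comm_ring_1)"
proof -
  obtain i i' where "i < n" "i' < n" "i \<noteq> i'" "f i = f i'"
    using assms by (auto simp: inj_on_def)
  then show ?thesis
    by (intro det_identical_rows[where n = n and i = i and j = i']) auto
qed

text \<open>Two bijections from \<open>S\<close> onto \<open>I\<close> differ by a permutation of
  \<open>S\<close>, so \<open>g\<close> parametrises all of them. The default values off
  \<open>S\<close> differ: \<open>restrict\<close> gives \<open>undefined\<close>, as the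
  extensional function space demands, while the inverse map is completed by the identity, as
  \<open>permutes\<close> demands.\<close>

lemma bij_betw_permutes_PiE:
  assumes g: "bij_betw g S I"
  shows "bij_betw (\<lambda>p. restrict (g \<circ> p) S) {p. p permutes S}
    {f \<in> S \<rightarrow>\<^sub>E I. bij_betw f S I}"
proof (rule bij_betw_byWitness[where f' = "\<lambda>f x. if x \<in> S then inv_into S g (f x) else x"])
  show "\<forall>p\<in>{p. p permutes S}.
      (\<lambda>x. if x \<in> S then inv_into S g (restrict (g \<circ> p) S x) else x) = p"
    using g by (auto simp: fun_eq_iff permutes_in_image permutes_not_in bij_betw_def)
  show "\<forall>f\<in>{f \<in> S \<rightarrow>\<^sub>E I. bij_betw f S I}.
      restrict (g \<circ> (\<lambda>x. if x \<in> S then inv_into S g (f x) else x)) S = f"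
  proof (intro ballI ext)
    fix f x assume f: "f \<in> {f \<in> S \<rightarrow>\<^sub>E I. bij_betw f S I}"
    show "restrict (g \<circ> (\<lambda>x. if x \<in> S then inv_into S g (f x) else x)) S x = f x"
    proof (cases "x \<in> S")
      case True
      then have "f x \<in> I" using f by auto
      then show ?thesis using True bij_betw_inv_into_right[OF g] by simp
    next
      case False
      then show ?thesis using f by auto
    qed
  qed
  show "(\<lambda>p. restrict (g \<circ> p) S) ` {p. p permutes S} \<subseteq> {f \<in> S \<rightarrow>\<^sub>E I. bij_betw f S I}"
  proof (rule image_subsetI)
    fix p assume "p \<in> {p. p permutes S}"
    then have "bij_betw (g \<circ> p) S I"
      using g by (blast intro: bij_betw_trans permutes_imp_bij)
    then have "bij_betw (restrict (g \<circ> p) S) S I"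
      by (simp cong: bij_betw_cong)
    then show "restrict (g \<circ> p) S \<in> {f \<in> S \<rightarrow>\<^sub>E I. bij_betw f S I}"
      by (auto dest: bij_betwE)
  qed
  show "(\<lambda>f x. if x \<in> S then inv_into S g (f x) else x) ` {f \<in> S \<rightarrow>\<^sub>E I. bij_betw f S I}
      \<subseteq> {p. p permutes S}"
  proof safe
    fix f assume "bij_betw f S I"
    then have "bij_betw (inv_into S g \<circ> f) S S"
      using g by (blast intro: bij_betw_trans bij_betw_inv_into)
    then have "bij_betw (\<lambda>x. if x \<in> S then inv_into S g (f x) else x) S S"
      by (simp cong: bij_betw_cong)
    then show "(\<lambda>x. if x \<in> S then inv_into S g (f x) else x) permutes S"
      by (rule bij_imp_permutes) simp
  qed
qed

text \<open>Expanding the products of sums gives a sum over all maps \<open>f\<close> from row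
  positions to \<open>K\<close>; repeated rows remove the non-injective ones, and the rest are
  grouped by image. Entry functions and an arbitrary finite \<open>K\<close> allow summing over a
  subset of the rows of a matrix without renumbering.\<close>

theorem Cauchy_Binet:
  fixes a b :: "nat \<Rightarrow> nat \<Rightarrow> 'a :: comm_ring_1"
  assumes K: "finite K"
  shows "det (mat n n (\<lambda>(i, j). \<Sum>r\<in>K. a i r * b r j)) =
    (\<Sum>I\<in>{I. I \<subseteq> K \<and> card I = n}.
      det (mat n n (\<lambda>(i, j). a i (pick I j))) * det (mat n n (\<lambda>(i, j). b (pick I i) j)))"
proof -
  let ?N = "{..<n}"
  let ?D = "\<lambda>f. (\<Prod>i\<in>?N. a i (f i)) * det (mat n n (\<lambda>(i, j). b (f i) j))"
  have fin: "finite (?N \<rightarrow>\<^sub>E K)" using K by (simp add: finite_PiE)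
  have "det (mat n n (\<lambda>(i, j). \<Sum>r\<in>K. a i r * b r j)) =
      (\<Sum>p | p permutes ?N. signof p * (\<Prod>i\<in>?N. \<Sum>r\<in>K. a i r * b r (p i)))"
    by (rule det_mat)
  also have "\<dots> = (\<Sum>p | p permutes ?N. \<Sum>f\<in>?N \<rightarrow>\<^sub>E K.
      (\<Prod>i\<in>?N. a i (f i)) * (signof p * (\<Prod>i\<in>?N. b (f i) (p i))))"
    using K by (simp add: prod_sum_PiE prod.distrib sum_distrib_left mult_ac)
  \<comment> \<open>For fixed \<open>f\<close>, the sum over \<open>p\<close> is the Leibniz
    expansion of the determinant whose row \<open>i\<close> is row \<open>f i\<close> of
    \<open>b\<close>.\<close>
  also have "\<dots> = (\<Sum>f\<in>?N \<rightarrow>\<^sub>E K. ?D f)"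
    unfolding det_mat sum_distrib_left by (rule sum.swap)
  also have "\<dots> = (\<Sum>f\<in>{f \<in> ?N \<rightarrow>\<^sub>E K. inj_on f ?N}. ?D f)"
    using fin by (intro sum.mono_neutral_right) (auto simp: det_rows_not_inj)
  also have "\<dots> = (\<Sum>I\<in>{I. I \<subseteq> K \<and> card I = n}.
      \<Sum>f\<in>{f \<in> {f \<in> ?N \<rightarrow>\<^sub>E K. inj_on f ?N}. f ` ?N = I}. ?D f)"
  proof (rule sum.group[symmetric])
    show "(\<lambda>f. f ` ?N) ` {f \<in> ?N \<rightarrow>\<^sub>E K. inj_on f ?N} \<subseteq> {I. I \<subseteq> K \<and> card I = n}"
      using card_image by fastforce
  qed (use K fin in simp_all)
  also have "\<dots> = (\<Sum>I\<in>{I. I \<subseteq> K \<and> card I = n}.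
      det (mat n n (\<lambda>(i, j). a i (pick I j))) * det (mat n n (\<lambda>(i, j). b (pick I i) j)))"
  proof (rule sum.cong[OF refl])
    fix I assume I: "I \<in> {I. I \<subseteq> K \<and> card I = n}"
    let ?B = "mat n n (\<lambda>(i, j). b (pick I i) j)"
    have g: "bij_betw (pick I) ?N I"
      using I K by (auto intro: bij_betw_pick finite_subset)
    \<comment> \<open>Taking the rows of \<open>I\<close> in the order given by \<open>p\<close>
      changes the minor of \<open>b\<close> only by the sign of \<open>p\<close>.\<close>
    have perm: "det (mat n n (\<lambda>(i, j). b (restrict (pick I \<circ> p) ?N i) j)) = signof p * det ?B"
      if "p permutes ?N" for p
    proof -
      have eq: "mat n n (\<lambda>(i, j). b (restrict (pick I \<circ> p) ?N i) j) =
          mat n n (\<lambda>(i, j). ?B $$ (p i, j))"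
        by (rule eq_matI) (use permutes_in_image[OF that] in simp_all)
      show ?thesis
        unfolding eq by (rule det_permute_rows) (use that in \<open>simp_all add: atLeast0LessThan\<close>)
    qed
    have fibre: "{f \<in> {f \<in> ?N \<rightarrow>\<^sub>E K. inj_on f ?N}. f ` ?N = I} = {f \<in> ?N \<rightarrow>\<^sub>E I. bij_betw f ?N I}"
      using I by (intro Collect_cong) (force simp: bij_betw_def PiE_iff)
    have "(\<Sum>f\<in>{f \<in> {f \<in> ?N \<rightarrow>\<^sub>E K. inj_on f ?N}. f ` ?N = I}. ?D f) =
        (\<Sum>p | p permutes ?N. ?D (restrict (pick I \<circ> p) ?N))"
      unfolding fibre by (rule sum.reindex_bij_betw[OF bij_betw_permutes_PiE[OF g], symmetric])
    \<comment> \<open>The sign now goes with the \<open>a\<close>-factors: the sum over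
      \<open>p\<close> becomes the Leibniz expansion of the minor of \<open>a\<close>.\<close>
    also have "\<dots> = (\<Sum>p | p permutes ?N. signof p * (\<Prod>i\<in>?N. a i (pick I (p i)))) * det ?B"
      unfolding sum_distrib_right
    proof (rule sum.cong[OF refl])
      fix p assume "p \<in> {p. p permutes ?N}"
      then have "p permutes ?N" by simp
      moreover have "(\<Prod>i\<in>?N. a i (restrict (pick I \<circ> p) ?N i)) = (\<Prod>i\<in>?N. a i (pick I (p i)))"
        by (rule prod.cong) simp_all
      ultimately show "?D (restrict (pick I \<circ> p) ?N) =
          signof p * (\<Prod>i\<in>?N. a i (pick I (p i))) * det ?B"
        by (simp only: perm mult_ac)
    qed
    also have "(\<Sum>p | p permutes ?N. signof p * (\<Prod>i\<in>?N. a i (pick I (p i)))) =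
        det (mat n n (\<lambda>(i, j). a i (pick I j)))"
      by (rule det_mat[symmetric])
    finally show "(\<Sum>f\<in>{f \<in> {f \<in> ?N \<rightarrow>\<^sub>E K. inj_on f ?N}. f ` ?N = I}. ?D f) =
        det (mat n n (\<lambda>(i, j). a i (pick I j))) * det ?B" .
  qed
  finally show ?thesis .
qed

text \<open>Both factors of Cauchy--Binet come from \<open>A\<close>, so the two minors belong to
  mutually transposed matrices and multiply to a square.\<close>

corollary Gram_det_rows:
  fixes A :: "'a :: comm_ring_1 mat"
  assumes A: "A \<in> carrier_mat m n" and K: "K \<subseteq> {..<m}"
  shows "det (mat n n (\<lambda>(i, j). \<Sum>r\<in>K. A $$ (r, i) * A $$ (r, j))) =
    (\<Sum>I\<in>{I. I \<subseteq> K \<and> card I = n}. (det (submatrix A I UNIV))\<^sup>2)"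
proof -
  have fin: "finite K" using K finite_subset by blast
  show ?thesis
    unfolding Cauchy_Binet[OF fin, where a = "\<lambda>i r. A $$ (r, i)" and b = "\<lambda>r j. A $$ (r, j)"]
  proof (rule sum.cong[OF refl])
    fix I assume "I \<in> {I. I \<subseteq> K \<and> card I = n}"
    then have I: "I \<subseteq> {..<m}" "card I = n" using K by auto
    let ?B = "mat n n (\<lambda>(i, j). A $$ (pick I i, j))"
    have B: "submatrix A I UNIV = ?B"
      by (rule submatrix_UNIV_eq[OF A I])
    have "mat n n (\<lambda>(i, j). A $$ (pick I j, i)) = transpose_mat ?B"
      by (auto intro!: eq_matI)
    then show "det (mat n n (\<lambda>(i, j). A $$ (pick I j, i))) * det ?B =
        (det (submatrix A I UNIV))\<^sup>2"
      by (simp add: B power2_eq_square det_transpose[where n = n])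
  qed
qed

text \<open>\<open>pick K\<close> reindexes the row sum. Passing through Gram matrices avoids
  identifying each minor of the selected rows with a minor of \<open>A\<close>.\<close>

lemma Gram_rows_submatrix:
  assumes A: "A \<in> carrier_mat m n" and K: "K \<subseteq> {..<m}" "card K = k"
  shows "mat n n (\<lambda>(i, j). \<Sum>r<k. rows_submatrix A K $$ (r, i) * rows_submatrix A K $$ (r, j)) =
    mat n n (\<lambda>(i, j). \<Sum>r\<in>K. A $$ (r, i) * A $$ (r, j))"
proof -
  have "bij_betw (pick K) {..<k} K"
    using K by (auto intro: bij_betw_pick finite_subset)
  then have "(\<Sum>r\<in>K. A $$ (r, i) * A $$ (r, j)) = (\<Sum>r<k. A $$ (pick K r, i) * A $$ (pick K r, j))"
    for i j by (rule sum.reindex_bij_betw[symmetric])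
  then show ?thesis
    by (auto simp: submatrix_UNIV_eq[OF assms] intro!: eq_matI)
qed

section \<open>Nonvanishing of the principal determinant and the square of
  \<open>Gdet\<close>\<close>

lemma permutes_extend_bij_betw:
  assumes "finite S" "T \<subseteq> S" "I \<subseteq> S" and g: "bij_betw g T I"
  obtains p where "p permutes S" "\<And>x. x \<in> T \<Longrightarrow> p x = g x"
proof -
  \<comment> \<open>The complements of \<open>T\<close> and \<open>I\<close> have equal size, so any
    bijection between them completes \<open>g\<close>.\<close>
  have "card (S - T) = card (S - I)"
    using assms bij_betw_same_card[OF g] by (simp add: card_Diff_subset finite_subset)
  then obtain h where h: "bij_betw h (S - T) (S - I)"
    using assms(1) by (metis finite_Diff finite_same_card_bij)
  let ?p = "\<lambda>x. if x \<in> T then g x else if x \<in> S then h x else x"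
  have "bij_betw ?p T I"
    using g by (simp cong: bij_betw_cong)
  moreover have "bij_betw ?p (S - T) (S - I)"
    using h by (rule bij_betw_cong[THEN iffD1, rotated]) simp
  ultimately have "bij_betw ?p (T \<union> (S - T)) (I \<union> (S - I))"
    by (rule bij_betw_combine) auto
  then have "?p permutes S"
    using assms by (intro bij_imp_permutes) (auto simp: Un_absorb1)
  then show ?thesis by (rule that) simp
qed

text \<open>A nonzero maximal minor forces full column rank and is the \<open>perm_part\<close> of
  some permutation; so the set whose maximum defines \<open>principal_perm\<close> is nonempty and
  contains that maximum.\<close>

lemma det_principal_submatrix_nonzero:
  assumes A: "A \<in> carrier_mat m n" and "n \<le> m"
    and I: "I \<subseteq> {..<m}" "card I = n" and nz: "det (rows_submatrix A I) \<noteq> 0"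
  shows "det (principal_submatrix A) \<noteq> 0"
proof -
  let ?S = "{s. s permutes {..<m} \<and> det (perm_part A s) \<noteq> 0}"
  have "n \<le> vec_space.rank m A"
    using vec_space.rank_gt_minor[OF A nz] by simp
  then have full: "full_col_rank A"
    using A vec_space.rank_le_nc[OF A] by (simp add: full_col_rank_def)
  have "bij_betw (pick I) {..<n} I"
    using I by (auto intro: bij_betw_pick finite_subset)
  then obtain p where p: "p permutes {..<m}" "\<And>j. j < n \<Longrightarrow> p j = pick I j"
    using I \<open>n \<le> m\<close> permutes_extend_bij_betw[of "{..<m}" "{..<n}" I "pick I"] by auto
  \<comment> \<open>The inverse appears because row \<open>j\<close> of \<open>perm_part A s\<close>
    is the row of \<open>A\<close> numbered by the preimage of \<open>j\<close> under
    \<open>s\<close>.\<close>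
  let ?s = "inv_into UNIV p"
  have s: "?s permutes {..<m}" using p by (simp add: permutes_inv)
  have "inv_into UNIV ?s = p" using p by (simp add: permutes_bij inv_inv_eq)
  then have "perm_part A ?s = rows_submatrix A I"
    unfolding submatrix_UNIV_eq[OF A I]
    using A perm_part_index[OF s A \<open>n \<le> m\<close>] p
    by (intro eq_matI) (auto simp: perm_part_def perm_proj_def rect_id_def)
  then have "?S \<noteq> {}" using s nz by auto
  then have "perm_max m ?S \<in> ?S"
    unfolding perm_max_def
    by (rule theI'[OF perm_max_ex1, THEN conjunct1, rotated]) auto
  then show ?thesis
    using A full by (simp add: principal_submatrix_def principal_perm_def)
qed

text \<open>The squared sign is 1 unless the principal determinant vanishes; in that case all
  maximal minors vanish too and both sides are 0.\<close>

lemma Gdet_square: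
  assumes A: "A \<in> carrier_mat m n" and "n \<le> m"
  shows "(Gdet A)\<^sup>2 = (\<Sum>I\<in>{I. I \<subseteq> {..<m} \<and> card I = n}. (det (rows_submatrix A I))\<^sup>2)"
proof (cases "det (principal_submatrix A) = 0")
  case True
  then have "(det (rows_submatrix A I))\<^sup>2 = 0" if "I \<subseteq> {..<m}" "card I = n" for I
    using det_principal_submatrix_nonzero[OF assms that] by auto
  then show ?thesis using True by (simp add: Gdet_def mat_sign_def)
next
  case False
  then have "(mat_sign A)\<^sup>2 = 1" by (simp add: mat_sign_def sgn_real_def)
  then show ?thesis
    using A by (simp add: Gdet_def power_mult_distrib sum_nonneg)
qed

lemma Gdet_rows_submatrix_square:
  assumes A: "A \<in> carrier_mat m n" and K: "K \<subseteq> {..<m}" "card K = k" and "n \<le> k"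
  shows "(Gdet (rows_submatrix A K))\<^sup>2 =
    (\<Sum>I\<in>{I. I \<subseteq> K \<and> card I = n}. (det (rows_submatrix A I))\<^sup>2)"
proof -
  have B: "rows_submatrix A K \<in> carrier_mat k n"
    by (simp add: submatrix_UNIV_eq[OF A K])
  \<comment> \<open>The minors of the selected rows are folded into a Gram determinant, which is
    rewritten over \<open>K\<close> and expanded again into minors of \<open>A\<close>.\<close>
  show ?thesis
    unfolding Gdet_square[OF B \<open>n \<le> k\<close>] Gram_det_rows[OF B order_refl, symmetric]
      Gram_rows_submatrix[OF A K] by (rule Gram_det_rows[OF A K(1)])
qed

section \<open>Counting the row sets that contain a given one\<close>

lemma card_supersets:
  assumes "finite S" "I \<subseteq> S" "card I \<le> k"
  shows "card {K. K \<subseteq> S \<and> card K = k \<and> I \<subseteq> K} = (card S - card I) choose (k - card I)"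
proof -
  have fI: "finite I" using assms finite_subset by blast
  have "bij_betw (\<lambda>K. K - I) {K. K \<subseteq> S \<and> card K = k \<and> I \<subseteq> K}
      {L. L \<subseteq> S - I \<and> card L = k - card I}"
  proof (rule bij_betw_byWitness[where f' = "\<lambda>L. L \<union> I"])
    show "(\<lambda>L. L \<union> I) ` {L. L \<subseteq> S - I \<and> card L = k - card I}
        \<subseteq> {K. K \<subseteq> S \<and> card K = k \<and> I \<subseteq> K}"
    proof safe
      fix L assume L: "L \<subseteq> S - I" "card L = k - card I"
      then have "finite L" "L \<inter> I = {}" using assms finite_subset by blast+
      \<comment> \<open>Subtraction is truncated: \<open>card I \<le> k\<close> makes the two sizes
        add up to \<open>k\<close>.\<close>
      then show "card (L \<union> I) = k" using L fI assms by (simp add: card_Un_disjoint)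
    qed (use assms in auto)
  qed (auto simp: card_Diff_subset fI)
  then have "card {K. K \<subseteq> S \<and> card K = k \<and> I \<subseteq> K} = card {L. L \<subseteq> S - I \<and> card L = k - card I}"
    by (rule bij_betw_same_card)
  also have "\<dots> = (card S - card I) choose (k - card I)"
    using assms by (simp add: n_subsets card_Diff_subset fI)
  finally show ?thesis .
qed

theorem theorem3p8:
  fixes A :: "real mat" and m n k :: nat
  assumes "1 \<le> n" and "n \<le> m"
    and "A \<in> carrier_mat m n"
    and "n \<le> k" and "k \<le> m"
  shows "real ((m - n) choose (k - n)) * det (transpose_mat A * A) =
    (\<Sum>I\<in>{I. I \<subseteq> {..<m} \<and> card I = k}. (Gdet (rows_submatrix A I))\<^sup>2)"
proof -
  note A = assms(3)
  let ?d = "\<lambda>I. (det (rows_submatrix A I))\<^sup>2"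
  let ?In = "{I. I \<subseteq> {..<m} \<and> card I = n}" and ?Ik = "{K. K \<subseteq> {..<m} \<and> card K = k}"
  have "(\<Sum>K\<in>?Ik. (Gdet (rows_submatrix A K))\<^sup>2) = (\<Sum>K\<in>?Ik. \<Sum>I\<in>{I. I \<subseteq> K \<and> card I = n}. ?d I)"
    using Gdet_rows_submatrix_square[OF A _ _ assms(4)] by (intro sum.cong) auto
  also have "\<dots> = (\<Sum>K\<in>?Ik. \<Sum>I\<in>{I \<in> ?In. I \<subseteq> K}. ?d I)"
    by (intro sum.cong) auto
  \<comment> \<open>Double counting: now the minor is fixed and the \<open>k\<close>-sets around its
    rows vary.\<close>
  also have "\<dots> = (\<Sum>I\<in>?In. \<Sum>K\<in>{K \<in> ?Ik. I \<subseteq> K}. ?d I)"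
    by (rule sum.swap_restrict) simp_all
  \<comment> \<open>The inner summand does not depend on \<open>K\<close>, so only the number of
    supersets matters.\<close>
  also have "\<dots> = (\<Sum>I\<in>?In. real ((m - n) choose (k - n)) * ?d I)"
    using card_supersets[of "{..<m}" _ k] assms(4) by (intro sum.cong) (auto simp: conj_assoc)
  also have "\<dots> = real ((m - n) choose (k - n)) * (\<Sum>I\<in>?In. ?d I)"
    by (simp add: sum_distrib_left)
  \<comment> \<open>With all of \<open>{..<m}\<close> as row set, the squared minors sum to the full
    Gram determinant.\<close>
  also have "(\<Sum>I\<in>?In. ?d I) = det (mat n n (\<lambda>(i, j). \<Sum>r<m. A $$ (r, i) * A $$ (r, j)))"
    by (rule Gram_det_rows[OF A order_refl, symmetric])
  also have "mat n n (\<lambda>(i, j). \<Sum>r<m. A $$ (r, i) * A $$ (r, j)) = transpose_mat A * A"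
    using A by (intro eq_matI) (auto simp: scalar_prod_def atLeast0LessThan)
  finally show ?thesis by (rule sym)
qed

end
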